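(* Let $a,b\in\mathbb{R}$, $\lambda>0$, $1<\omega\leq2$. If $$\lambda^2-a^2-b^2-\sqrt{(a^2+b^2)^2+\lambda(-2a^3+6ab^2)+\lambda^2(a^2+b^2)}>0,$$ then the matrix $$P=\begin{pmatrix}\frac{\lambda}{2}(a^2-2a\lambda-3b^2+\lambda^2)(2a+\lambda)&0&0\\0&-(a\lambda+2b^2-\lambda^2)&b(2a+\lambda)\\0&b(2a+\lambda)&-(a-\lambda)(2a+\lambda)\end{pmatrix}$$ symmetrizes the equivalent system of the D2Q3 model, i.e. $P$ is symmetric positive definite and $PA^1$, $PA^2$ are symmetric, where $A^1,A^2$ are the first-order matrices given in the context. Consequently, under this condition the equivalent system of the D2Q3 model is hyperbolic.
   Context: The equivalent system of the D2Q3 vectorial lattice-Boltzmann model (kinetic velocities $(\lambda,0)$, $\frac{\lambda}{2}(-1,\sqrt3)$, $\frac{\lambda}{2}(-1,-\sqrt3)$, relaxation parameter $\omega$, time step $\Delta t$) for the scalar transport equation $\partial_t w+\partial_1(aw)+\partial_2(bw)=0$, in the unknowns $Y=(w,y_1,y_2)^{\intercal}$ where $(y_1,y_2)$ is the flux error, is $$\partial_tY-\frac{\omega(\omega-2)(\omega^2-2\omega+2)}{2\Delta t(\omega-1)^2}\begin{pmatrix}0\\ y_1\\ y_2\end{pmatrix}+A^1\partial_1Y+A^2\partial_2Y=O(\Delta t),$$ $$A^1=\begin{pmatrix}a&-2\gamma_1&0\\\gamma_1(2a+\lambda)(a-\lambda)&\gamma_2(2a-\lambda)&0\\\gamma_1b(2a+\lambda)&2b\gamma_2&\gamma_2\lambda\end{pmatrix},\quad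 A^2=\begin{pmatrix}b&0&-2\gamma_1\\\gamma_1b(2a+\lambda)&0&\gamma_2(2a+\lambda)\\\gamma_1(a\lambda+2b^2-\lambda^2)&\gamma_2\lambda&2b\gamma_2\end{pmatrix},$$ with $$\gamma_1=-\frac{1}{16}\frac{(\omega^2-2\omega+2)(\omega-2)^2}{(\omega-1)^2},\qquad\gamma_2=-\frac14\frac{\omega^4-4\omega^3+6\omega^2-4\omega+2}{(\omega-1)^2}.$$ Definition: an equivalent system with first-order matrices $A^1,\dots,A^d$ (here $d=2$) is called hyperbolic if and only if there exists a symmetric positive definite matrix $P^0$ such that $P^0A^i$ is symmetric for all $1\leq i\leq d$. Such a matrix is said to symmetrize the system. *)

theory Defs
  imports "HOL-Analysis.Analysis"
begin

definition sym_pos_def :: "real^'n^'n \<Rightarrow> bool" where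
  "sym_pos_def P \<longleftrightarrow> transpose P = P \<and> (\<forall>x. x \<noteq> 0 \<longrightarrow> x \<bullet> (P *v x) > 0)"

(* A system with first-order part A^1 d_1 Y + ... + A^d d_d Y is represented by the family of its
   first-order matrices, A $ i being A^i. Time derivative and relaxation term play no role below. *)
definition symmetrizes :: "real^'n^'n \<Rightarrow> real^'n^'n^'d \<Rightarrow> bool" where
  "symmetrizes P A \<longleftrightarrow> sym_pos_def P \<and> (\<forall>i. transpose (P ** A $ i) = P ** A $ i)"

definition hyperbolic :: "real^'n^'n^'d \<Rightarrow> bool" where
  "hyperbolic A \<longleftrightarrow> (\<exists>P. symmetrizes P A)"

definition gamma1 :: "real \<Rightarrow> real" where
  "gamma1 \<omega> = - (1/16) * ((\<omega>^2 - 2*\<omega> + 2) * (\<omega> - 2)^2 / (\<omega> - 1)^2)"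

definition gamma2 :: "real \<Rightarrow> real" where
  "gamma2 \<omega> = - (1/4) * ((\<omega>^4 - 4*\<omega>^3 + 6*\<omega>^2 - 4*\<omega> + 2) / (\<omega> - 1)^2)"

(* First-order matrices of the equivalent system of the D2Q3 scheme with kinetic velocities
   (l,0), l/2 (-1, sqrt 3), l/2 (-1, -sqrt 3) and relaxation parameter \<omega>, for the transport equation
   d_t w + d_1 (a w) + d_2 (b w) = 0; the unknowns are (w, y1, y2) with (y1, y2) the flux error.
   Matrices are listed by rows. *)
definition D2Q3_A1 :: "real \<Rightarrow> real \<Rightarrow> real \<Rightarrow> real \<Rightarrow> real^3^3" where
  "D2Q3_A1 a b l \<omega> = vector [
     vector [a, - 2 * gamma1 \<omega>, 0],
     vector [gamma1 \<omega> * (2*a + l) * (a - l), gamma2 \<omega> * (2*a - l), 0],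
     vector [gamma1 \<omega> * b * (2*a + l), 2 * b * gamma2 \<omega>, gamma2 \<omega> * l]]"

definition D2Q3_A2 :: "real \<Rightarrow> real \<Rightarrow> real \<Rightarrow> real \<Rightarrow> real^3^3" where
  "D2Q3_A2 a b l \<omega> = vector [
     vector [b, 0, - 2 * gamma1 \<omega>],
     vector [gamma1 \<omega> * b * (2*a + l), 0, gamma2 \<omega> * (2*a + l)],
     vector [gamma1 \<omega> * (a*l + 2*b^2 - l^2), gamma2 \<omega> * l, 2 * b * gamma2 \<omega>]]"

definition D2Q3_system :: "real \<Rightarrow> real \<Rightarrow> real \<Rightarrow> real \<Rightarrow> real^3^3^2" where
  "D2Q3_system a b l \<omega> = vector [D2Q3_A1 a b l \<omega>, D2Q3_A2 a b l \<omega>]"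

definition D2Q3_P :: "real \<Rightarrow> real \<Rightarrow> real \<Rightarrow> real^3^3" where
  "D2Q3_P a b l = vector [
     vector [l/2 * (a^2 - 2*a*l - 3*b^2 + l^2) * (2*a + l), 0, 0],
     vector [0, - (a*l + 2*b^2 - l^2), b * (2*a + l)],
     vector [0, b * (2*a + l), - ((a - l) * (2*a + l))]]"

end

theory Submission
  imports Defs
begin

text \<open>
  Let \<open>D = (a\<^sup>2 - 2 a l - 3 b\<^sup>2 + l\<^sup>2) (2 a + l)\<close>. The entries of \<open>P\<close> are such that
  its upper left entry is \<open>l D / 2\<close> and the determinant of its lower right block is \<open>l D\<close>.
  With \<open>z = a + i b\<close>, the radicand is \<open>\<bar>z\<^sup>2 - l z\<^sup>*\<bar>\<^sup>2\<close> (\<open>z\<^sup>*\<close> the conjugate), so the hypothesis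
  can be squared, and what is left is exactly \<open>l D > 0\<close>. The condition \<open>D > 0\<close> describes the open
  triangle spanned by the three kinetic velocities together with unbounded regions; these regions
  are excluded by \<open>a\<^sup>2 + b\<^sup>2 < l\<^sup>2\<close>, whence \<open>2 a + l > 0\<close>.
\<close>

lemma sqrt_less_imp_less_power2:
  fixes x y :: real
  assumes "0 \<le> x" and "sqrt x < y"
  shows "x < y\<^sup>2"
proof -
  have "(sqrt x)\<^sup>2 < y\<^sup>2"
    using assms by (intro power_strict_mono) auto
  then show ?thesis
    using assms(1) by simp
qed

text \<open>Multiplying by \<open>r\<close> completes the square in \<open>z\<close> without a
  division; what remains is the determinant times \<open>y^2\<close>.\<close>

lemma quadratic_form_pos:
  fixes p q r y z :: real
  assumes r: "0 < r" and det: "0 < p * r - q\<^sup>2" and nz: "y \<noteq> 0 \<or> z \<noteq> 0"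
  shows "0 < p * y\<^sup>2 + 2 * q * y * z + r * z\<^sup>2"
proof -
  have eq: "r * (p * y\<^sup>2 + 2 * q * y * z + r * z\<^sup>2) = (r * z + q * y)\<^sup>2 + (p * r - q\<^sup>2) * y\<^sup>2"
    by algebra
  have "0 < (r * z + q * y)\<^sup>2 + (p * r - q\<^sup>2) * y\<^sup>2"
  proof (cases "y = 0")
    case True
    then show ?thesis using r nz by simp
  next
    case False
    then show ?thesis using det by (intro add_nonneg_pos mult_pos_pos) auto
  qed
  then show ?thesis
    using r by (simp add: eq[symmetric] zero_less_mult_iff)
qed

text \<open>Sylvester's criterion on the lower block, with \<open>r\<close> in place of
  \<open>p\<close> as the minor of size one: for \<open>D2Q3_P\<close>, \<open>r\<close> is
  \<open>(l - a) * (2*a + l)\<close>, whose sign can be read off its factors.\<close>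

lemma sym_pos_def_block_1_2:
  fixes d p q r :: real
  assumes "0 < d" and "0 < r" and "0 < p * r - q\<^sup>2"
  shows "sym_pos_def (vector [vector [d, 0, 0], vector [0, p, q], vector [0, q, r]] :: real^3^3)"
    (is "sym_pos_def ?M")
  unfolding sym_pos_def_def
proof (intro conjI allI impI)
  show "transpose ?M = ?M"
    by (simp add: vec_eq_iff forall_3 transpose_def)
next
  fix x :: "real^3"
  assume "x \<noteq> 0"
  then have nz: "x$1 \<noteq> 0 \<or> x$2 \<noteq> 0 \<or> x$3 \<noteq> 0"
    by (auto simp: vec_eq_iff forall_3)
  have form: "x \<bullet> (?M *v x) =
      d * (x$1)\<^sup>2 + (p * (x$2)\<^sup>2 + 2 * q * x$2 * x$3 + r * (x$3)\<^sup>2)"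
    by (simp add: inner_vec_def matrix_vector_mult_def sum_3 power2_eq_square algebra_simps)
  show "0 < x \<bullet> (?M *v x)"
  proof (cases "x$2 = 0 \<and> x$3 = 0")
    case True
    then show ?thesis using nz assms(1) by (simp add: form)
  next
    case False
    then have "0 < p * (x$2)\<^sup>2 + 2 * q * x$2 * x$3 + r * (x$3)\<^sup>2"
      using assms by (intro quadratic_form_pos) auto
    then show ?thesis
      using assms(1) by (simp add: form add_nonneg_pos)
  qed
qed

lemma transpose_eq_self_iff_3:
  fixes M :: "'a^3^3"
  shows "transpose M = M \<longleftrightarrow> M$1$2 = M$2$1 \<and> M$1$3 = M$3$1 \<and> M$2$3 = M$3$2"
  by (auto simp: vec_eq_iff forall_3 transpose_def)

text \<open>\<open>gamma1\<close> and \<open>gamma2\<close> stay folded: mirrored entries are linear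
  in them, with equal polynomial coefficients in \<open>a\<close>, \<open>b\<close>,
  \<open>l\<close>.\<close>

lemma D2Q3_sym_A1:
  "transpose (D2Q3_P a b l ** D2Q3_A1 a b l \<omega>) = D2Q3_P a b l ** D2Q3_A1 a b l \<omega>"
  unfolding D2Q3_P_def D2Q3_A1_def transpose_eq_self_iff_3 matrix_matrix_mult_def sum_3
    vec_lambda_beta vector_3
  by (simp add: algebra_simps power2_eq_square add_divide_distrib diff_divide_distrib)

lemma D2Q3_sym_A2:
  "transpose (D2Q3_P a b l ** D2Q3_A2 a b l \<omega>) = D2Q3_P a b l ** D2Q3_A2 a b l \<omega>"
  unfolding D2Q3_P_def D2Q3_A2_def transpose_eq_self_iff_3 matrix_matrix_mult_def sum_3
    vec_lambda_beta vector_3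
  by (simp add: algebra_simps power2_eq_square add_divide_distrib diff_divide_distrib)

text \<open>The first factor is \<open>(a - l)^2 - 3 * b^2\<close>, which vanishes on the two sides
  of the triangle through \<open>(l, 0)\<close>; the third side is
  \<open>2*a + l = 0\<close>.\<close>

lemma D2Q3_condition_imp:
  fixes a b l :: real
  assumes l: "0 < l"
    and cond: "l^2 - a^2 - b^2
      - sqrt ((a^2 + b^2)^2 + l * (- 2 * a^3 + 6 * a * b^2) + l^2 * (a^2 + b^2)) > 0"
  shows "0 < (a^2 - 2*a*l - 3*b^2 + l^2) * (2*a + l)" and "a < l" and "0 < 2*a + l"
proof -
  let ?Q = "(a^2 + b^2)^2 + l * (- 2 * a^3 + 6 * a * b^2) + l^2 * (a^2 + b^2)"
  have "?Q = (a^2 - b^2 - l * a)^2 + (2 * a * b + l * b)^2"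
    by algebra
  then have Q: "0 \<le> ?Q"
    by simp
  have "?Q < (l^2 - a^2 - b^2)^2"
    using cond by (intro sqrt_less_imp_less_power2[OF Q]) simp
  moreover have "(l^2 - a^2 - b^2)^2 - ?Q = l * ((a^2 - 2*a*l - 3*b^2 + l^2) * (2*a + l))"
    by algebra
  ultimately have "0 < l * ((a^2 - 2*a*l - 3*b^2 + l^2) * (2*a + l))"
    by linarith
  then show D: "0 < (a^2 - 2*a*l - 3*b^2 + l^2) * (2*a + l)"
    using l by (simp only: zero_less_mult_pos)
  have disc: "a^2 + b^2 < l^2"
    using cond real_sqrt_ge_zero[OF Q] by linarith
  then have "a^2 < l^2"
    using zero_le_power2[of b] by linarith
  then show al: "a < l"
    using l by (auto intro: power2_less_imp_less[of a l])
  show "0 < 2*a + l"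
  proof (rule ccontr)
    assume "\<not> 0 < 2*a + l"
    with D have neg: "2*a + l < 0" "a^2 - 2*a*l - 3*b^2 + l^2 < 0"
      by (auto simp: zero_less_mult_iff)
    \<comment> \<open>Within the disc but beyond the third side, the first factor splits into two
      positive terms, against \<open>neg\<close>.\<close>
    have "0 < 3 * (l^2 - a^2 - b^2) + 2 * ((l - a) * - (2*a + l))"
      using disc al neg(1) by (intro add_pos_pos mult_pos_pos) auto
    also have "\<dots> = a^2 - 2*a*l - 3*b^2 + l^2"
      by algebra
    finally show False
      using neg(2) by simp
  qed
qed

theorem theorem19:
  fixes a b l \<omega> :: real
  assumes "l > 0" and "1 < \<omega>" and "\<omega> \<le> 2"
    and "l^2 - a^2 - b^2
      - sqrt ((a^2 + b^2)^2 + l * (- 2 * a^3 + 6 * a * b^2) + l^2 * (a^2 + b^2)) > 0"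
  shows "symmetrizes (D2Q3_P a b l) (D2Q3_system a b l \<omega>) \<and> hyperbolic (D2Q3_system a b l \<omega>)"
proof -
  note pos = D2Q3_condition_imp[OF assms(1,4)]
  have "sym_pos_def (D2Q3_P a b l)"
    unfolding D2Q3_P_def
  proof (rule sym_pos_def_block_1_2)
    show "0 < l/2 * (a^2 - 2*a*l - 3*b^2 + l^2) * (2*a + l)"
      using mult_pos_pos[OF half_gt_zero[OF assms(1)] pos(1)] by (simp only: mult.assoc)
    show "0 < - ((a - l) * (2*a + l))"
      using mult_neg_pos[of "a - l" "2*a + l"] pos(2,3) by simp
    have "- (a*l + 2*b^2 - l^2) * - ((a - l) * (2*a + l)) - (b * (2*a + l))\<^sup>2
        = l * ((a^2 - 2*a*l - 3*b^2 + l^2) * (2*a + l))"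
      by algebra
    then show "0 < - (a*l + 2*b^2 - l^2) * - ((a - l) * (2*a + l)) - (b * (2*a + l))\<^sup>2"
      using mult_pos_pos[OF assms(1) pos(1)] by simp
  qed
  then have "symmetrizes (D2Q3_P a b l) (D2Q3_system a b l \<omega>)"
    by (simp add: symmetrizes_def forall_2 D2Q3_system_def D2Q3_sym_A1 D2Q3_sym_A2)
  then show ?thesis
    by (auto simp: hyperbolic_def)
qed

end
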